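(* ($\mathsf{ZFC}$) Suppose that $\mathscr{U}$ is a normal measure over $\kappa$, that $\lambda$ is a singular cardinal with $\mathrm{cf}(\lambda)=\kappa$, and that $\mathrm{Gal}(\mathscr{U},\mu,\mu)$ holds for cofinally many regular cardinals $\mu$ below $\lambda$. Then $\lambda\rightarrow(\lambda,\omega+1)^2$.
   Context: A normal measure over $\kappa$ is a non-principal $\kappa$-complete normal ultrafilter over the uncountable cardinal $\kappa$. $\mathrm{Gal}(\mathscr{U},\mu,\mu)$ means: every sequence $\langle C_\gamma\mid\gamma<\mu\rangle$ of elements of $\mathscr{U}$ (repetitions allowed) admits a subfamily $\langle C_{\gamma_i}\mid i<\mu\rangle$ (with pairwise distinct indices $\gamma_i$) such that $\bigcap_{i<\mu}C_{\gamma_i}\in\mathscr{U}$. $\lambda\rightarrow(\alpha,\beta)^2$ means: for every $c\colon[\lambda]^2\to 2$, either there is $A\subseteq\lambda$ of order type $\alpha$ such that $c$ is constantly $0$ on $[A]^2$, or there is $B\subseteq\lambda$ of order type $\beta$ such that $c$ is constantly $1$ on $[B]^2$. *)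

theory Defs
  imports Main "HOL-Library.Ramsey" "HOL-Library.Extended_Nat"
begin

unbundle cardinal_syntax

text \<open>
  Cardinals are represented by well-orders \<open>r\<close> satisfying \<^const>\<open>Card_order\<close>. The ordinals below
  such a cardinal are the elements of \<^term>\<open>Field r\<close>, ordered by \<open>r\<close>. Every cardinal below
  \<open>l :: 'a rel\<close> is isomorphic to some \<open>m :: 'a rel\<close>, so quantifying over \<open>'a rel\<close> reaches all
  of them. As \<^const>\<open>regularCard\<close> holds vacuously for finite orders, regular cardinals are
  those satisfying both \<^const>\<open>regularCard\<close> and \<open>Cinfinite\<close>.
\<close>

definition singular_card :: "'a rel \<Rightarrow> bool" where
  "singular_card l \<longleftrightarrow> Cinfinite l \<and> \<not> regularCard l"

text \<open>\<open>k = cf(l)\<close>: the least cardinality of a cofinal subset, for \<open>l\<close> without a last element.\<close>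

definition is_cofinality :: "'a rel \<Rightarrow> 'k rel \<Rightarrow> bool" where
  "is_cofinality l k \<longleftrightarrow>
     Card_order k \<and>
     (\<exists>A \<subseteq> Field l. cofinal A l \<and> |A| =o k) \<and>
     (\<forall>A \<subseteq> Field l. cofinal A l \<longrightarrow> k \<le>o |A| )"

definition ultrafilter_on :: "'k set \<Rightarrow> 'k set set \<Rightarrow> bool" where
  "ultrafilter_on X U \<longleftrightarrow>
     U \<subseteq> Pow X \<and> X \<in> U \<and> {} \<notin> U \<and>
     (\<forall>A B. A \<in> U \<and> A \<subseteq> B \<and> B \<subseteq> X \<longrightarrow> B \<in> U) \<and>
     (\<forall>A B. A \<in> U \<and> B \<in> U \<longrightarrow> A \<inter> B \<in> U) \<and>
     (\<forall>A. A \<subseteq> X \<longrightarrow> A \<in> U \<or> X - A \<in> U)"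

definition principal_on :: "'k set \<Rightarrow> 'k set set \<Rightarrow> bool" where
  "principal_on X U \<longleftrightarrow> (\<exists>x\<in>X. U = {A. A \<subseteq> X \<and> x \<in> A})"

definition complete_wrt :: "'k rel \<Rightarrow> 'k set set \<Rightarrow> bool" where
  "complete_wrt k U \<longleftrightarrow> (\<forall>F. F \<subseteq> U \<and> F \<noteq> {} \<and> |F| <o k \<longrightarrow> \<Inter>F \<in> U)"

definition diag_inter :: "'k rel \<Rightarrow> ('k \<Rightarrow> 'k set) \<Rightarrow> 'k set" where
  "diag_inter k C = {x \<in> Field k. \<forall>y \<in> underS k x. x \<in> C y}"

definition closed_diag_inter :: "'k rel \<Rightarrow> 'k set set \<Rightarrow> bool" where
  "closed_diag_inter k U \<longleftrightarrow>
     (\<forall>C. (\<forall>x \<in> Field k. C x \<in> U) \<longrightarrow> diag_inter k C \<in> U)"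

definition normal_measure :: "'k rel \<Rightarrow> 'k set set \<Rightarrow> bool" where
  "normal_measure k U \<longleftrightarrow>
     Card_order k \<and> natLeq <o k \<and>
     ultrafilter_on (Field k) U \<and> \<not> principal_on (Field k) U \<and>
     complete_wrt k U \<and> closed_diag_inter k U"

text \<open>The Galvin property \<open>Gal(U, m, m)\<close>; \<open>f\<close> picks the pairwise distinct indices of the subfamily.\<close>

definition Gal :: "'k set set \<Rightarrow> 'm rel \<Rightarrow> bool" where
  "Gal U m \<longleftrightarrow>
     (\<forall>C. (\<forall>x \<in> Field m. C x \<in> U) \<longrightarrow>
        (\<exists>f. f ` Field m \<subseteq> Field m \<and> inj_on f (Field m) \<and>
             (\<Inter>i \<in> Field m. C (f i)) \<in> U))"

text \<open>
  The partition relation \<open>l \<rightarrow> (a, b)\<^sup>2\<close>, for well-orders \<open>l\<close>, \<open>a\<close>, \<open>b\<close>. A subset \<open>A\<close> of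
  \<^term>\<open>Field l\<close> has order type \<open>a\<close> iff the restriction of \<open>l\<close> to \<open>A\<close> is isomorphic to \<open>a\<close>.
\<close>

definition has_order_type :: "'a rel \<Rightarrow> 'a set \<Rightarrow> 'b rel \<Rightarrow> bool" where
  "has_order_type l A a \<longleftrightarrow> A \<subseteq> Field l \<and> Restr l A =o a"

definition arrow2 :: "'a rel \<Rightarrow> 'b rel \<Rightarrow> 'c rel \<Rightarrow> bool" where
  "arrow2 l a b \<longleftrightarrow>
     (\<forall>c \<in> [Field l]\<^bsup>2\<^esup> \<rightarrow> {..<2::nat}.
        (\<exists>A. has_order_type l A a \<and> (\<forall>e \<in> [A]\<^bsup>2\<^esup>. c e = 0)) \<or>
        (\<exists>B. has_order_type l B b \<and> (\<forall>e \<in> [B]\<^bsup>2\<^esup>. c e = 1)))"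

text \<open>The ordinal \<open>\<omega> + 1\<close>, realised as the natural numbers with a greatest element added.\<close>

definition omega_plus_one :: "enat rel" where
  "omega_plus_one = {(x, y). x \<le> y}"

lemma Field_omega_plus_one: "Field omega_plus_one = UNIV"
  by (auto simp: omega_plus_one_def Field_def)

lemma Well_order_omega_plus_one: "Well_order omega_plus_one"
proof -
  have "omega_plus_one - Id = {(x, y). x < y}"
    by (auto simp: omega_plus_one_def)
  then have "wf (omega_plus_one - Id)"
    by (simp add: wf)
  then show ?thesis
    unfolding well_order_on_def linear_order_on_def partial_order_on_def preorder_on_def
      Field_omega_plus_one
    by (auto simp: omega_plus_one_def refl_on_def trans_def antisym_def total_on_def)
qed

end

theory Submission
  imports Defs
begin

text \<open>
  Call \<open>x < y\<close> adjacent if \<open>{x, y}\<close> has colour \<open>1\<close>, and suppose that there is no homogeneous set of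
  colour \<open>1\<close> and type \<open>\<omega> + 1\<close>. Cut \<open>\<lambda>\<close> into \<open>\<kappa>\<close> consecutive blocks \<open>B\<^sub>j\<close> of regular size \<open>\<lambda>\<^sub>j\<close>
  with the Galvin property; by \<open>\<mu> \<rightarrow> (\<mu>, \<omega> + 1)\<^sup>2\<close> for regular uncountable \<open>\<mu>\<close> the blocks may be taken
  free of edges. Given subsets \<open>D\<^sub>j\<close> of full size for \<open>U\<close>-many \<open>j\<close>, call \<open>x\<close> rich if it has \<open>\<lambda>\<^sub>j\<close>
  neighbours in \<open>D\<^sub>j\<close> for \<open>U\<close>-many \<open>j\<close>. If no vertex is rich, then the Galvin property makes the
  measure-one sets witnessing this uniform inside each block, a diagonal intersection makes them
  uniform across blocks, and deleting the few remaining neighbours leaves an edge-free set of size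
  \<open>\<lambda>\<close>. Otherwise rich vertices can be chosen successively, each time shrinking \<open>D\<^sub>j\<close> to their
  neighbours. For each \<open>y \<in> B\<^sub>j\<close> the tree of finite chains below \<open>y\<close> is well-founded with fewer than
  \<open>\<lambda>\<^sub>j\<close> possible ranks, so \<open>D\<^sub>j\<close> can be thinned to make the rank of the current chain constant.
  These constants decrease at every step for \<open>U\<close>-many \<open>j\<close>, contradicting countable completeness.
\<close>

section \<open>Cardinal arithmetic\<close>

lemma UN_ordLess:
  assumes "regularCard r" "Cinfinite r" "|I| <o r" "\<And>i. i \<in> I \<Longrightarrow> |A i| <o r"
  shows "|\<Union>i\<in>I. A i| <o r"
  using card_of_UNION_ordLess_infinite_Field_regularCard assms by blast

lemma ordLess_subset: "A \<subseteq> B \<Longrightarrow> |B| <o r \<Longrightarrow> |A| <o r"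
  using card_of_mono1 ordLeq_ordLess_trans by blast

lemma finite_ordLess_Cinfinite: "finite A \<Longrightarrow> Cinfinite r \<Longrightarrow> |A| <o r"
  by (metis Cfinite_ordLess_Cinfinite Field_card_of card_of_Card_order cfinite_def)

text \<open>Finite subsets are sorted by cardinality: each layer \<open>P (Suc n)\<close> is at most
  as large as \<open>X \<times> P n\<close>, and countably many layers do not exceed an infinite
  \<open>X\<close>.\<close>

lemma Fpow_ordLeq_infinite:
  assumes "infinite X"
  shows "|Fpow X| \<le>o |X|"
proof -
  define P where "P n = {t. t \<subseteq> X \<and> finite t \<and> card t = n}" for n
  have P: "|P n| \<le>o |X|" for n
  proof (induction n)
    case 0
    have "P 0 = {{}}" by (auto simp: P_def)
    then show ?case using assms by (metis card_of_singl_ordLeq finite.emptyI)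
  next
    case (Suc n)
    have "P (Suc n) \<subseteq> (\<lambda>(x, t). insert x t) ` (X \<times> P n)"
    proof
      fix t assume "t \<in> P (Suc n)"
      then have t: "t \<subseteq> X" "finite t" "card t = Suc n" by (auto simp: P_def)
      then obtain x u where "t = insert x u" "x \<notin> u" "card u = n" "finite u"
        by (metis card_Suc_eq finite_insert)
      then have "(x, u) \<in> X \<times> P n" "t = (\<lambda>(x, t). insert x t) (x, u)" using t by (auto simp: P_def)
      then show "t \<in> (\<lambda>(x, t). insert x t) ` (X \<times> P n)" by (rule rev_image_eqI)
    qed
    then have "|P (Suc n)| \<le>o |X \<times> P n|" by (rule surj_imp_ordLeq)
    also have "|X \<times> P n| \<le>o |X|"
      using assms Suc card_of_Card_order ordIso_imp_ordLeq[OF card_of_refl]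
      by (intro card_of_Times_ordLeq_infinite_Field) (simp_all add: Field_card_of)
    finally show ?case .
  qed
  have "Fpow X = (\<Union>n\<in>UNIV. P n)" by (auto simp: Fpow_def P_def)
  moreover have "|\<Union>n\<in>UNIV. P n| \<le>o |X|"
    using assms P by (intro card_of_UNION_ordLeq_infinite) (auto simp: infinite_iff_card_of_nat)
  ultimately show ?thesis by simp
qed

lemma Fpow_ordLess:
  assumes "Cinfinite r" "|X| <o r"
  shows "|Fpow X| <o r"
proof (cases "finite X")
  case True
  then have "finite (Fpow X)" by (metis Fpow_subset_Pow finite_Pow_iff finite_subset)
  then show ?thesis using assms finite_ordLess_Cinfinite by blast
next
  case False
  then show ?thesis using Fpow_ordLeq_infinite assms ordLeq_ordLess_trans by blast
qed

text \<open>Pigeonhole for regular cardinals: fewer than \<open>r\<close> fibres, each smaller than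
  \<open>r\<close>, could not cover \<open>S\<close>.\<close>

lemma regular_fibre:
  assumes "regularCard r" "Cinfinite r" "|S| =o r" "|f ` S| <o r"
  obtains v where "v \<in> f ` S" "|{y \<in> S. f y = v}| =o r"
proof -
  have "S = (\<Union>v\<in>f ` S. {y \<in> S. f y = v})" by auto
  moreover have "\<not> |S| <o r" using assms(3) not_ordLess_ordIso by blast
  ultimately obtain v where v: "v \<in> f ` S" "\<not> |{y \<in> S. f y = v}| <o r"
    using UN_ordLess[OF assms(1,2,4), of "\<lambda>v. {y \<in> S. f y = v}"] by fastforce
  moreover have "|{y \<in> S. f y = v}| \<le>o r"
    using card_of_mono1[of "{y \<in> S. f y = v}" S] assms(3) by (simp add: ordLeq_ordIso_trans)
  ultimately show ?thesis using that ordLeq_iff_ordLess_or_ordIso by blast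
qed

lemma ordIso_of_subset:
  assumes "A \<subseteq> S" "|S| =o r" "\<not> |A| <o r"
  shows "|A| =o r"
  using assms card_of_mono1 ordLeq_iff_ordLess_or_ordIso ordLeq_ordIso_trans by blast

lemma Diff_ordIso:
  assumes "Cinfinite r" "|S| =o r" "|B| <o r"
  shows "|S - B| =o r"
proof (rule ordIso_of_subset[OF _ assms(2)])
  show "\<not> |S - B| <o r"
  proof
    assume "|S - B| <o r"
    then have "|(S - B) \<union> B| <o r"
      using assms card_of_Un_ordLess_infinite_Field cinfinite_def by blast
    then have "|S| <o r" by (rule ordLess_subset[rotated]) auto
    then show False using assms(2) not_ordLess_ordIso by blast
  qed
qed auto

section \<open>The regular case\<close>

text \<open>
  \<open>adj x y\<close> will mean that \<open>x < y\<close> and that \<open>{x, y}\<close> has colour \<open>1\<close>; then a colour-\<open>1\<close> homogeneous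
  set of order type \<open>\<omega> + 1\<close> is the same thing as the following configuration.
\<close>

definition omega_one_chain :: "('a \<Rightarrow> 'a \<Rightarrow> bool) \<Rightarrow> (nat \<Rightarrow> 'a) \<Rightarrow> 'a \<Rightarrow> bool" where
  "omega_one_chain adj x y \<longleftrightarrow> (\<forall>n. adj (x n) y) \<and> (\<forall>m n. m < n \<longrightarrow> adj (x m) (x n))"

definition edge_free :: "('a \<Rightarrow> 'a \<Rightarrow> bool) \<Rightarrow> 'a set \<Rightarrow> bool" where
  "edge_free adj H \<longleftrightarrow> (\<forall>x\<in>H. \<forall>y\<in>H. \<not> adj x y)"

text \<open>The longer set is the predecessor, so well-foundedness forbids infinite growth and a
  minimal element is a set that cannot be extended.\<close>

definition extends_below :: "('a \<Rightarrow> 'a \<Rightarrow> bool) \<Rightarrow> 'a \<Rightarrow> ('a set \<times> 'a set) set" where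
  "extends_below adj y = {(insert x t, t) | x t. adj x y \<and> (\<forall>z\<in>t. adj z x)}"

text \<open>The vertices added along an infinite descending sequence are joined to all later ones
  and to \<open>y\<close>, which is the forbidden configuration.\<close>

lemma wf_extends_below:
  assumes "\<nexists>x. omega_one_chain adj x y"
  shows "wf (extends_below adj y)"
  unfolding wf_iff_no_infinite_down_chain
proof
  assume "\<exists>f. \<forall>i. (f (Suc i), f i) \<in> extends_below adj y"
  then obtain f where f: "\<And>i. (f (Suc i), f i) \<in> extends_below adj y" by blast
  have "\<exists>x. f (Suc i) = insert x (f i) \<and> adj x y \<and> (\<forall>z\<in>f i. adj z x)" for i
    using f[of i] unfolding extends_below_def by auto
  then obtain x where x: "f (Suc i) = insert (x i) (f i)" "adj (x i) y" "\<forall>z\<in>f i. adj z (x i)" for i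
    by metis
  have "x m \<in> f n" if "m < n" for m n
    using that by (induction n) (auto simp: x(1) less_Suc_eq)
  with x have "omega_one_chain adj x y" by (auto simp: omega_one_chain_def)
  with assms show False by blast
qed

text \<open>
  The case of a regular cardinal: \<open>s y\<close> is a maximal finite chain below \<open>y\<close>, and pressing down
  makes it constant on a large set, which is then edge-free by maximality.
\<close>

lemma regular_edge_free:
  fixes l :: "'a rel"
  assumes l: "Well_order l" and S: "S \<subseteq> Field l"
    and adj: "\<And>x y. adj x y \<Longrightarrow> (x, y) \<in> l \<and> x \<noteq> y"
    and chain: "\<nexists>x y. omega_one_chain adj x y"
    and r: "regularCard r" "Cinfinite r" "natLeq <o r" and card: "|S| =o r"
    and seg: "\<And>v. v \<in> S \<Longrightarrow> |S \<inter> underS l v| <o r"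
  obtains H where "H \<subseteq> S" "|H| =o r" "edge_free adj H"
proof -
  define lt where "lt x y \<longleftrightarrow> (x, y) \<in> l \<and> x \<noteq> y" for x y
  have wo: "wo_rel l" using l by (simp add: wo_rel_def)
  have tr: "trans l" and anti: "antisym l" and tot: "Total l"
    using wo by (auto simp: wo_rel.TRANS wo_rel.ANTISYM wo_rel.TOTAL)
  have lt_trans: "lt x z" if "lt x y" "lt y z" for x y z
    using that tr anti unfolding lt_def trans_def antisym_def by blast
  have lt_asym: "\<not> lt y x" if "lt x y" for x y
    using that anti unfolding lt_def antisym_def by blast
  have lt_total: "x = y \<or> lt x y \<or> lt y x" if "x \<in> S" "y \<in> S" for x y
    using that tot S unfolding lt_def total_on_def by blast
  \<comment> \<open>Regularity bounds small subsets of \<open>S\<close>: fewer than \<open>r\<close>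
    closed segments, each smaller than \<open>r\<close>, cannot cover \<open>S\<close>.\<close>
  have bound: "\<exists>q\<in>S. \<forall>u\<in>B. lt u q" if "B \<subseteq> S" "|B| <o r" for B
  proof -
    have "|\<Union>v\<in>B. insert v (S \<inter> underS l v)| <o r"
    proof (rule UN_ordLess[OF r(1,2) that(2)])
      fix v assume "v \<in> B"
      then have "|S \<inter> underS l v| <o r" using seg that by blast
      moreover have "|{v}| <o r" using finite_ordLess_Cinfinite[of "{v}"] r by blast
      ultimately have "|{v} \<union> (S \<inter> underS l v)| <o r"
        using card_of_Un_ordLess_infinite_Field r(2) cinfinite_def by blast
      then show "|insert v (S \<inter> underS l v)| <o r" by simp
    qed
    then have "\<not> S \<subseteq> (\<Union>v\<in>B. insert v (S \<inter> underS l v))"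
      using card ordLess_subset not_ordLess_ordIso by blast
    then obtain q where q: "q \<in> S" "\<forall>v\<in>B. q \<notin> insert v (S \<inter> underS l v)" by blast
    have "lt u q" if "u \<in> B" for u
      using q lt_total[of u q] that \<open>B \<subseteq> S\<close> by (auto simp: lt_def underS_def)
    with q show ?thesis by blast
  qed
  \<comment> \<open>Minimality of \<open>t\<close> in the well-founded relation says that no
    neighbour of \<open>y\<close> in \<open>S\<close> can be appended to it.\<close>
  have "\<exists>t. t \<in> Fpow {z \<in> S. adj z y} \<and> (\<forall>x\<in>S. adj x y \<longrightarrow> \<not> (\<forall>z\<in>t. adj z x))" for y
  proof -
    have "wf (extends_below adj y)" using chain wf_extends_below by metis
    then obtain t where t: "t \<in> Fpow {z \<in> S. adj z y}"
      "\<And>u. (u, t) \<in> extends_below adj y \<Longrightarrow> u \<notin> Fpow {z \<in> S. adj z y}"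
      by (rule wfE_min[OF _ empty_in_Fpow]) blast
    then show ?thesis unfolding extends_below_def Fpow_def by blast
  qed
  then obtain s where s: "\<And>y. s y \<in> Fpow {z \<in> S. adj z y}"
    and smax: "\<And>x y. x \<in> S \<Longrightarrow> adj x y \<Longrightarrow> \<not> (\<forall>z\<in>s y. adj z x)"
    by metis
  \<comment> \<open>The pressing-down argument: if all fibres of \<open>s\<close> were small,
    iterating a closure step \<open>g\<close> would lead to a limit point \<open>d\<close> whose
    finite set \<open>s d\<close> already lies below some stage, forcing \<open>d\<close> below the
    next one.\<close>
  have "\<exists>t. |{y \<in> S. s y = t}| =o r"
  proof (rule ccontr)
    assume "\<not> ?thesis"
    have small: "|{y \<in> S. s y = t}| <o r" for t
    proof (rule ccontr)
      assume "\<not> |{y \<in> S. s y = t}| <o r"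
      then have "|{y \<in> S. s y = t}| =o r" by (rule ordIso_of_subset[OF Collect_restrict card])
      with \<open>\<nexists>t. |{y \<in> S. s y = t}| =o r\<close> show False by blast
    qed
    \<comment> \<open>The segment below \<open>p\<close> has fewer than \<open>r\<close> finite
      subsets, and each is the value of \<open>s\<close> at fewer than \<open>r\<close> points, so
      one bound serves them all.\<close>
    have "\<exists>q\<in>S. lt p q \<and> (\<forall>y\<in>S. s y \<subseteq> S \<inter> underS l p \<longrightarrow> lt y q)" if p: "p \<in> S" for p
    proof -
      let ?B = "insert p (\<Union>t\<in>Fpow (S \<inter> underS l p). {y \<in> S. s y = t})"
      have "|{p} \<union> (\<Union>t\<in>Fpow (S \<inter> underS l p). {y \<in> S. s y = t})| <o r"
      proof (rule card_of_Un_ordLess_infinite_Field)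
        show "|\<Union>t\<in>Fpow (S \<inter> underS l p). {y \<in> S. s y = t}| <o r"
          by (rule UN_ordLess[OF r(1,2) Fpow_ordLess[OF r(2) seg[OF p]] small])
      qed (use r(2) finite_ordLess_Cinfinite[of "{p}" r] in \<open>auto simp: cinfinite_def\<close>)
      then obtain q where q: "q \<in> S" "\<forall>u\<in>?B. lt u q"
        using bound[of ?B] p by auto
      have "lt y q" if "y \<in> S" "s y \<subseteq> S \<inter> underS l p" for y
      proof -
        have "s y \<in> Fpow (S \<inter> underS l p)" using s[of y] that by (auto simp: Fpow_def)
        then show ?thesis using q that by blast
      qed
      then show ?thesis using q by blast
    qed
    then obtain g where g: "\<And>p. p \<in> S \<Longrightarrow> g p \<in> S" "\<And>p. p \<in> S \<Longrightarrow> lt p (g p)"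
      "\<And>p y. p \<in> S \<Longrightarrow> y \<in> S \<Longrightarrow> s y \<subseteq> S \<inter> underS l p \<Longrightarrow> lt y (g p)"
      by metis
    obtain p0 where p0: "p0 \<in> S"
      using bound[of "{}"] finite_ordLess_Cinfinite[OF finite.emptyI r(2)] by auto
    define q where "q n = (g ^^ n) p0" for n
    have q: "q n \<in> S" for n by (induction n) (auto simp: q_def p0 g)
    have qS: "q (Suc n) = g (q n)" for n by (simp add: q_def)
    have q_less: "lt (q m) (q n)" if "m < n" for m n
      using that
    proof (induction n)
      case (Suc n)
      then show ?case using g(2)[OF q[of n]] lt_trans[of "q m" "q n"]
        by (auto simp: qS less_Suc_eq)
    qed simp
    let ?T = "{d \<in> S. \<forall>n. lt (q n) d}"
    have "|range q| <o r"
    proof -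
      \<comment> \<open>Uncountability of \<open>r\<close> is what bounds the sequence
        \<open>q\<close> inside \<open>S\<close>.\<close>
      have "|UNIV :: nat set| <o r"
        using r(3) card_of_nat ordIso_ordLess_trans by blast
      then show ?thesis using card_of_image ordLeq_ordLess_trans by blast
    qed
    then obtain d0 where "d0 \<in> S" "\<forall>u\<in>range q. lt u d0" using bound[of "range q"] q by auto
    then have "d0 \<in> ?T" by blast
    \<comment> \<open>\<open>d\<close> is the supremum of the \<open>q n\<close> within
      \<open>S\<close>: every smaller point of \<open>S\<close> fails to exceed some
      \<open>q n\<close>.\<close>
    then obtain d where d: "d \<in> ?T" and dmin: "\<And>e. (e, d) \<in> l - Id \<Longrightarrow> e \<notin> ?T"
      by (rule wfE_min[OF wo_rel.WF[OF wo]]) blast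
    have "\<exists>n. z \<in> underS l (q n)" if "z \<in> s d" for z
    proof -
      have z: "z \<in> S" "lt z d" using s[of d] that adj by (auto simp: Fpow_def lt_def)
      then obtain n where "\<not> lt (q n) z" using dmin[of z] by (auto simp: lt_def)
      then have "z = q n \<or> lt z (q n)" using lt_total[OF z(1) q[of n]] by blast
      then have "lt z (q (Suc n))" using g(2)[OF q[of n]] lt_trans[of z "q n"] by (auto simp: qS)
      then show ?thesis by (auto simp: lt_def underS_def)
    qed
    then obtain N where N: "\<And>z. z \<in> s d \<Longrightarrow> z \<in> underS l (q (N z))" by metis
    have fin: "finite (s d)" "s d \<subseteq> S" using s[of d] by (auto simp: Fpow_def)
    \<comment> \<open>The \<open>0\<close> gives \<open>Max\<close> a value when \<open>s d\<close>
      is empty; \<open>Suc\<close> makes every \<open>N z\<close> strictly less than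
      \<open>K\<close>, as \<open>q_less\<close> requires.\<close>
    define K where "K = Suc (Max (insert 0 (N ` s d)))"
    have "z \<in> underS l (q K)" if "z \<in> s d" for z
    proof -
      have "N z < K" using that fin by (auto simp: K_def less_Suc_eq_le)
      then have "lt (q (N z)) (q K)" by (rule q_less)
      then show ?thesis using N[OF that] lt_trans[of z "q (N z)"] by (auto simp: lt_def underS_def)
    qed
    then have "lt d (q (Suc K))" using g(3)[OF q[of K], of d] d fin by (auto simp: qS)
    moreover have "lt (q (Suc K)) d" using d by blast
    ultimately show False using lt_asym by blast
  qed
  then obtain t where t: "|{y \<in> S. s y = t}| =o r" by (elim exE)
  \<comment> \<open>An edge from \<open>x\<close> to \<open>y\<close> would let \<open>x\<close>
    extend \<open>s y\<close>, because all of \<open>s y = s x\<close> is adjacent to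
    \<open>x\<close>.\<close>
  have "\<not> adj x y" if "x \<in> S" "y \<in> S" "s x = t" "s y = t" for x y
  proof
    assume "adj x y"
    moreover have "\<forall>z\<in>s x. adj z x" using s[of x] by (simp add: Fpow_def subset_iff)
    ultimately show False using smax[of x y] that by simp
  qed
  then have "edge_free adj {y \<in> S. s y = t}" by (simp add: edge_free_def)
  with t show ?thesis by (intro that) auto
qed

section \<open>Systems of blocks\<close>

text \<open>A bijection \<open>h\<close> moves the index set from \<open>Field m\<close> to
  \<open>D\<close>; injectivity of the chosen indices becomes full size of \<open>E\<close>.\<close>

lemma Gal_subset:
  assumes "Gal U m" "Card_order m" "|D| =o m" "\<And>x. x \<in> D \<Longrightarrow> C x \<in> U"
  obtains E where "E \<subseteq> D" "|E| =o m" "(\<Inter>x\<in>E. C x) \<in> U"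
proof -
  have Fm: "|Field m| =o m" using assms(2) by (rule card_of_Field_ordIso)
  then have "|Field m| =o |D|" using ordIso_symmetric[OF assms(3)] by (rule ordIso_transitive)
  then obtain h where h: "bij_betw h (Field m) D" using card_of_ordIso by blast
  then have "\<forall>x\<in>Field m. C (h x) \<in> U" using assms(4) by (simp add: bij_betw_apply)
  then have "\<exists>f. f ` Field m \<subseteq> Field m \<and> inj_on f (Field m) \<and> (\<Inter>i\<in>Field m. C (h (f i))) \<in> U"
    by (rule assms(1)[unfolded Gal_def, THEN spec, THEN mp])
  then obtain f where f: "f ` Field m \<subseteq> Field m" "inj_on f (Field m)"
    "(\<Inter>i\<in>Field m. C (h (f i))) \<in> U"
    by (elim exE conjE)
  have hf: "inj_on (h \<circ> f) (Field m)"
    by (rule comp_inj_on[OF f(2) inj_on_subset[OF bij_betw_imp_inj_on[OF h] f(1)]])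
  show ?thesis
  proof
    show "(h \<circ> f) ` Field m \<subseteq> D" using f(1) h by (auto simp: bij_betw_def)
    have "|Field m| =o |(h \<circ> f) ` Field m|" by (rule card_of_ordIsoI[OF inj_on_imp_bij_betw[OF hf]])
    then show "|(h \<circ> f) ` Field m| =o m" by (rule ordIso_transitive[OF ordIso_symmetric Fm])
    show "(\<Inter>x\<in>(h \<circ> f) ` Field m. C x) \<in> U" using f(3) by simp
  qed
qed

section \<open>Closure properties of normal ultrafilters\<close>

locale normal_ultrafilter =
  fixes k :: "'k rel" and U :: "'k set set"
  assumes normal_measure: "normal_measure k U"
begin

lemma Card_order: "Card_order k"
  and natLeq: "natLeq <o k"
  and complete: "\<And>F. F \<subseteq> U \<Longrightarrow> F \<noteq> {} \<Longrightarrow> |F| <o k \<Longrightarrow> \<Inter>F \<in> U"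
  and diag: "\<And>C. (\<And>x. x \<in> Field k \<Longrightarrow> C x \<in> U) \<Longrightarrow> diag_inter k C \<in> U"
  and ultrafilter: "ultrafilter_on (Field k) U"
  and nonprincipal: "\<not> principal_on (Field k) U"
  using normal_measure
  by (auto simp: normal_measure_def complete_wrt_def closed_diag_inter_def)

lemma subset_Field: "A \<in> U \<Longrightarrow> A \<subseteq> Field k"
proof -
  have "U \<subseteq> Pow (Field k)" using ultrafilter unfolding ultrafilter_on_def by (elim conjE)
  then show "A \<in> U \<Longrightarrow> A \<subseteq> Field k" by blast
qed

lemma Field_mem: "Field k \<in> U"
  using ultrafilter unfolding ultrafilter_on_def by (elim conjE)

lemma empty_notin: "{} \<notin> U"
  using ultrafilter unfolding ultrafilter_on_def by (elim conjE)

lemma mono: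
  assumes "A \<in> U" "A \<subseteq> B" "B \<subseteq> Field k"
  shows "B \<in> U"
proof -
  have "\<forall>A B. A \<in> U \<and> A \<subseteq> B \<and> B \<subseteq> Field k \<longrightarrow> B \<in> U"
    using ultrafilter unfolding ultrafilter_on_def by (elim conjE)
  with assms show ?thesis by (meson conjI)
qed

lemma Int_mem:
  assumes "A \<in> U" "B \<in> U"
  shows "A \<inter> B \<in> U"
proof -
  have "\<forall>A B. A \<in> U \<and> B \<in> U \<longrightarrow> A \<inter> B \<in> U"
    using ultrafilter unfolding ultrafilter_on_def by (elim conjE)
  with assms show ?thesis by simp
qed

lemma Diff_mem:
  assumes "A \<subseteq> Field k" "A \<notin> U"
  shows "Field k - A \<in> U"
proof -
  have "\<forall>A. A \<subseteq> Field k \<longrightarrow> A \<in> U \<or> Field k - A \<in> U"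
    using ultrafilter unfolding ultrafilter_on_def by (elim conjE)
  with assms show ?thesis by blast
qed

lemma Int_empty: "A \<in> U \<Longrightarrow> B \<in> U \<Longrightarrow> A \<inter> B \<noteq> {}"
  using Int_mem[of A B] empty_notin by metis

lemma singleton_notin: "{x} \<notin> U"
proof
  assume x: "{x} \<in> U"
  have "U = {A. A \<subseteq> Field k \<and> x \<in> A}"
  proof (intro set_eqI iffI)
    fix A assume A: "A \<in> U"
    then show "A \<in> {A. A \<subseteq> Field k \<and> x \<in> A}" using Int_empty[OF x A] subset_Field[OF A] by simp
  next
    fix A assume "A \<in> {A. A \<subseteq> Field k \<and> x \<in> A}"
    then show "A \<in> U" by (intro mono[OF x]) simp_all
  qed
  moreover have "x \<in> Field k" using subset_Field[OF x] by simp
  ultimately have "principal_on (Field k) U" unfolding principal_on_def by (rule rev_bexI[rotated])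
  then show False using nonprincipal by contradiction
qed

lemma Cinfinite: "Cinfinite k"
  using Card_order cinfinite_mono[OF ordLess_imp_ordLeq[OF natLeq] natLeq_cinfinite] by simp

lemma INT_mem:
  assumes "I \<noteq> {}" "|I| <o k" "\<And>i. i \<in> I \<Longrightarrow> A i \<in> U"
  shows "(\<Inter>i\<in>I. A i) \<in> U"
proof (rule complete)
  show "|A ` I| <o k" by (rule ordLeq_ordLess_trans[OF card_of_image assms(2)])
  show "A ` I \<subseteq> U" using assms(3) by blast
  show "A ` I \<noteq> {}" using assms(1) by simp
qed

text \<open>Complements of singletons have measure one by nonprincipality, and completeness
  intersects fewer than \<open>k\<close> of them. The empty set is separate because an empty
  intersection would be the whole type.\<close>

lemma Diff_small_mem:
  assumes "|A| <o k"
  shows "Field k - A \<in> U"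
proof (cases "A = {}")
  case False
  have "(\<Inter>x\<in>A. Field k - {x}) \<in> U"
  proof (rule INT_mem[OF False assms])
    fix x show "Field k - {x} \<in> U"
      by (cases "x \<in> Field k") (simp_all add: Diff_mem singleton_notin Field_mem)
  qed
  then show ?thesis by (rule mono) (use False in auto)
qed (simp add: Field_mem)

lemma tail_mem:
  assumes "i \<in> Field k"
  shows "{j \<in> Field k. i \<in> underS k j} \<in> U"
proof -
  have wo: "wo_rel k" using Card_order by (simp add: wo_rel_def card_order_on_well_order_on)
  have "|{i} \<union> underS k i| <o k"
    using card_of_underS[OF Card_order assms] Cinfinite finite_ordLess_Cinfinite[of "{i}" k]
    by (intro card_of_Un_ordLess_infinite_Field) (simp_all add: cinfinite_def)
  then have "Field k - ({i} \<union> underS k i) \<in> U" by (rule Diff_small_mem)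
  moreover have "Field k - ({i} \<union> underS k i) \<subseteq> {j \<in> Field k. i \<in> underS k j}"
  proof
    fix j assume j: "j \<in> Field k - ({i} \<union> underS k i)"
    then have "(i, j) \<in> k \<or> (j, i) \<in> k" using wo_rel.TOTALS[OF wo] assms by blast
    then show "j \<in> {j \<in> Field k. i \<in> underS k j}" using j by (simp add: underS_def) metis
  qed
  ultimately show ?thesis by (rule mono) (rule Collect_restrict)
qed

lemma countable_INT_mem:
  assumes "\<And>n :: nat. A n \<in> U"
  shows "(\<Inter>n. A n) \<in> U"
proof (rule INT_mem)
  show "|UNIV :: nat set| <o k" by (rule ordIso_ordLess_trans[OF card_of_nat natLeq])
qed (simp_all add: assms)

end

text \<open>
  \<open>B j\<close> for \<open>j \<in> Field k\<close> are consecutive blocks. The cardinals \<open>M j\<close> strictly between the size of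
  the earlier blocks and that of \<open>B j\<close> are used as value sets for rank functions.
\<close>

locale edge_blocks = normal_ultrafilter k U
  for k :: "'k rel" and U +
  fixes B :: "'k \<Rightarrow> 'a set" and M :: "'k \<Rightarrow> 'a rel" and adj :: "'a \<Rightarrow> 'a \<Rightarrow> bool"
  assumes block_free: "\<And>j. j \<in> Field k \<Longrightarrow> edge_free adj (B j)"
    and block_order: "\<And>i j x y. j \<in> Field k \<Longrightarrow> i \<in> underS k j \<Longrightarrow> x \<in> B i \<Longrightarrow> y \<in> B j \<Longrightarrow> \<not> adj y x"
    and block_regular: "\<And>j. j \<in> Field k \<Longrightarrow> regularCard |B j|"
    and M_regular: "\<And>j. j \<in> Field k \<Longrightarrow> Cinfinite (M j) \<and> regularCard (M j)"
    and below_M: "\<And>j. j \<in> Field k \<Longrightarrow> |\<Union>i\<in>underS k j. B i| <o M j"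
    and M_block: "\<And>j. j \<in> Field k \<Longrightarrow> M j <o |B j|"
    and block_Gal: "\<And>j. j \<in> Field k \<Longrightarrow> Gal U |B j|"
begin

lemma block_Cinfinite: "j \<in> Field k \<Longrightarrow> Cinfinite |B j|"
  using M_regular[of j] cinfinite_mono[OF ordLess_imp_ordLeq[OF M_block]] card_of_Card_order by auto

definition full :: "'k set \<Rightarrow> ('k \<Rightarrow> 'a set) \<Rightarrow> bool" where
  "full I D \<longleftrightarrow> I \<in> U \<and> (\<forall>j\<in>I. D j \<subseteq> B j \<and> |D j| =o |B j| )"

text \<open>Requiring \<open>i \<in> underS k j\<close> keeps only blocks beyond that of
  \<open>x\<close>, so \<open>x\<close> lies in the union of earlier blocks for every surviving
  \<open>j\<close>.\<close>

definition rich :: "'k set \<Rightarrow> ('k \<Rightarrow> 'a set) \<Rightarrow> 'k \<Rightarrow> 'a \<Rightarrow> bool" where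
  "rich I D i x \<longleftrightarrow> {j \<in> I. i \<in> underS k j \<and> |{y \<in> D j. adj x y}| =o |B j| } \<in> U"

lemma large_edge_free_if_no_rich:
  assumes full: "full I D" and no_rich: "\<And>i x. i \<in> I \<Longrightarrow> x \<in> D i \<Longrightarrow> \<not> rich I D i x"
  obtains H where "H \<subseteq> (\<Union>j\<in>Field k. B j)" "edge_free adj H" "{j \<in> Field k. |B j| \<le>o |H| } \<in> U"
proof -
  have I: "I \<in> U" "I \<subseteq> Field k" and D: "\<And>j. j \<in> I \<Longrightarrow> D j \<subseteq> B j" "\<And>j. j \<in> I \<Longrightarrow> |D j| =o |B j|"
    using full subset_Field by (auto simp: full_def)
  \<comment> \<open>The blocks in which \<open>x\<close> has few neighbours; for a vertex that is
    not rich they form a measure-one set.\<close>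
  define C where "C x = {j \<in> Field k. |{y \<in> D j. adj x y}| <o |B j| }" for x
  have C: "C x \<in> U" if "i \<in> I" "x \<in> D i" for i x
  proof -
    let ?R = "{j \<in> I. i \<in> underS k j \<and> |{y \<in> D j. adj x y}| =o |B j| }"
    have "Field k - ?R \<in> U"
      using no_rich[OF that] I by (intro Diff_mem) (auto simp: rich_def)
    then have "(Field k - ?R) \<inter> I \<inter> {j \<in> Field k. i \<in> underS k j} \<in> U"
      using I that tail_mem[of i] by (intro Int_mem) auto
    moreover have "(Field k - ?R) \<inter> I \<inter> {j \<in> Field k. i \<in> underS k j} \<subseteq> C x"
    proof
      fix j assume j: "j \<in> (Field k - ?R) \<inter> I \<inter> {j \<in> Field k. i \<in> underS k j}"
      then have "\<not> |{y \<in> D j. adj x y}| =o |B j|" by blast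
      then have "|{y \<in> D j. adj x y}| <o |B j|"
        using ordIso_of_subset[of "{y \<in> D j. adj x y}", OF Collect_restrict D(2)[of j]] j by auto
      with j show "j \<in> C x" by (simp add: C_def)
    qed
    ultimately show ?thesis by (rule mono) (auto simp: C_def)
  qed
  \<comment> \<open>The Galvin property replaces the sets \<open>C x\<close>, which vary with
    \<open>x\<close>, by one measure-one set serving a subset of full size.\<close>
  have "\<exists>E. E \<subseteq> D i \<and> |E| =o |B i| \<and> (\<Inter>x\<in>E. C x) \<in> U" if i: "i \<in> I" for i
  proof -
    have "Gal U |B i|" using i I by (intro block_Gal) auto
    then obtain E where "E \<subseteq> D i" "|E| =o |B i|" "(\<Inter>x\<in>E. C x) \<in> U"
      by (rule Gal_subset[OF _ card_of_Card_order D(2)[OF i] C[OF i]])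
    then show ?thesis by (intro exI conjI)
  qed
  then obtain E where E: "\<And>i. i \<in> I \<Longrightarrow> E i \<subseteq> D i" "\<And>i. i \<in> I \<Longrightarrow> |E i| =o |B i|"
    "\<And>i. i \<in> I \<Longrightarrow> (\<Inter>x\<in>E i. C x) \<in> U" by metis
  have EB: "E i \<subseteq> B i" if "i \<in> I" for i using E(1)[OF that] D(1)[OF that] by (rule order_trans)
  \<comment> \<open>The default \<open>Field k\<close> makes every entry of the diagonal
    intersection measure one. Each \<open>j\<close> in \<open>J\<close> then lies in
    \<open>C x\<close> for all \<open>x\<close> in the earlier \<open>E i\<close> with
    \<open>i\<close> in \<open>J\<close>.\<close>
  define J where "J = I \<inter> diag_inter k (\<lambda>i. if i \<in> I then \<Inter>x\<in>E i. C x else Field k)"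
  have J: "J \<in> U" unfolding J_def using E(3) I(1) by (intro Int_mem diag) (simp_all add: Field_mem)
  have JI: "J \<subseteq> I" "J \<subseteq> Field k" using I by (auto simp: J_def)
  have JC: "j \<in> C x" if "j \<in> J" "i \<in> J" "i \<in> underS k j" "x \<in> E i" for i j x
    using that by (auto simp: J_def diag_inter_def split: if_splits)
  define N where "N j = (\<Union>x\<in>(\<Union>i\<in>J \<inter> underS k j. E i). {y \<in> D j. adj x y})" for j
  \<comment> \<open>Fewer than \<open>|B j|\<close> earlier vertices have fewer than
    \<open>|B j|\<close> neighbours each, so by regularity deleting \<open>N j\<close> does not
    reduce the size of \<open>E j\<close>.\<close>
  have N: "|N j| <o |B j|" if "j \<in> J" for j
    unfolding N_def
  proof (rule UN_ordLess)
    have j: "j \<in> Field k" using that JI by blast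
    then show "regularCard |B j|" "Cinfinite |B j|" using block_regular block_Cinfinite by auto
    have "(\<Union>i\<in>J \<inter> underS k j. E i) \<subseteq> (\<Union>i\<in>underS k j. B i)"
      by (rule UN_mono) (use EB JI in auto)
    then show "|\<Union>i\<in>J \<inter> underS k j. E i| <o |B j|"
      by (rule ordLess_subset[OF _ ordLess_transitive[OF below_M[OF j] M_block[OF j]]])
  next
    fix x assume "x \<in> (\<Union>i\<in>J \<inter> underS k j. E i)"
    then show "|{y \<in> D j. adj x y}| <o |B j|" using JC that by (auto simp: C_def)
  qed
  define H where "H = (\<Union>j\<in>J. E j - N j)"
  have HB: "E j - N j \<subseteq> B j" if "j \<in> J" for j using that EB JI(1) by blast
  show ?thesis
  proof
    show "H \<subseteq> (\<Union>j\<in>Field k. B j)" using HB JI unfolding H_def by blast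
    show "edge_free adj H"
      unfolding edge_free_def
    proof (intro ballI notI)
      fix x y assume "x \<in> H" "y \<in> H" and xy: "adj x y"
      then obtain i j where i: "i \<in> J" "x \<in> E i - N i" and j: "j \<in> J" "y \<in> E j - N j"
        by (auto simp: H_def)
      have fld: "i \<in> Field k" "j \<in> Field k" using i j JI by auto
      have xB: "x \<in> B i" "y \<in> B j" using HB i j by blast+
      have "wo_rel k" using Card_order by (simp add: wo_rel_def card_order_on_well_order_on)
      then consider "i = j" | "j \<in> underS k i" | "i \<in> underS k j"
        using fld by (metis wo_rel.TOTALS underS_I)
      then show False
      proof cases
        case 1
        then show ?thesis using block_free[OF fld(1)] xB xy by (auto simp: edge_free_def)
      next
        case 2
        then show ?thesis using block_order[OF fld(1) 2 xB(2,1)] xy by blast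
      next
        case 3
        then have "y \<in> N j" using i j xy E(1) JI by (auto simp: N_def)
        then show ?thesis using j by blast
      qed
    qed
    have "|B j| \<le>o |H|" if "j \<in> J" for j
    proof -
      have "|E j - N j| =o |B j|"
        using that JI by (intro Diff_ordIso N E block_Cinfinite) auto
      moreover have "|E j - N j| \<le>o |H|" using that by (intro card_of_mono1) (auto simp: H_def)
      ultimately show ?thesis by (rule ordIso_ordLeq_trans[OF ordIso_symmetric])
    qed
    then have "J \<subseteq> {j \<in> Field k. |B j| \<le>o |H| }" using JI by blast
    then show "{j \<in> Field k. |B j| \<le>o |H| } \<in> U" using J mono by auto
  qed
qed

end

section \<open>Rank functions and the descent along rich vertices\<close>

text \<open>Failure of cofinality gives only a weak upper bound \<open>u\<close>; an infinite
  cardinal has no last element, so some larger \<open>v\<close> is a strict one.\<close>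

lemma not_cofinal_bounded:
  assumes r: "Cinfinite r" and K: "K \<subseteq> Field r" "\<not> cofinal K r"
  obtains v where "v \<in> Field r" "K \<subseteq> underS r v"
proof -
  obtain u where u: "u \<in> Field r" "\<forall>w\<in>K. \<not> (u \<noteq> w \<and> (u, w) \<in> r)"
    using K(2) by (auto simp: cofinal_def)
  obtain v where v: "v \<in> Field r" "u \<noteq> v" "(u, v) \<in> r"
    using infinite_Card_order_limit[of r u] r u(1) by (auto simp: cinfinite_def)
  have wo: "wo_rel r" using r by (simp add: wo_rel_def card_order_on_well_order_on)
  have "w \<in> underS r v" if w: "w \<in> K" for w
  proof -
    have "w = u \<or> (w, u) \<in> r"
      using u w K(1) wo_rel.TOTALS[OF wo] by (metis subsetD)
    then have "(w, v) \<in> r" using v transD[OF wo_rel.TRANS[OF wo]] by metis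
    moreover have "w \<noteq> v" using \<open>w = u \<or> (w, u) \<in> r\<close> v antisymD[OF wo_rel.ANTISYM[OF wo]] by metis
    ultimately show ?thesis by (simp add: underS_def)
  qed
  with v(1) show ?thesis by (intro that) auto
qed

text \<open>Recursion along \<open>R\<close>: the values at predecessors in \<open>A\<close> form a
  set smaller than the regular \<open>r\<close>, hence bounded. Counting only predecessors in
  \<open>A\<close> keeps the ranks inside \<open>Field r\<close>.\<close>

lemma rank_function:
  assumes wf: "wf R" and A: "|A| <o r" and r: "Cinfinite r" "regularCard r"
  obtains f where "\<And>b. f b \<in> Field r" "\<And>a b. a \<in> A \<Longrightarrow> (a, b) \<in> R \<Longrightarrow> f a \<in> underS r (f b)"
proof -
  have "\<exists>f. \<forall>b. f b \<in> Field r \<and> f ` {a \<in> A. (a, b) \<in> R} \<subseteq> underS r (f b)"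
  proof (rule dependent_wf_choice[OF wf,
        where P = "\<lambda>f b v. v \<in> Field r \<and> f ` {a \<in> A. (a, b) \<in> R} \<subseteq> underS r v"])
    fix f b
    assume f: "\<And>a. (a, b) \<in> R \<Longrightarrow> f a \<in> Field r \<and> f ` {a' \<in> A. (a', a) \<in> R} \<subseteq> underS r (f a)"
    let ?K = "f ` {a \<in> A. (a, b) \<in> R}"
    have K: "?K \<subseteq> Field r" using f by blast
    moreover have "|?K| <o r"
      by (rule ordLeq_ordLess_trans[OF card_of_image ordLess_subset[OF Collect_restrict A]])
    then have "\<not> cofinal ?K r" using K r(2) not_ordLess_ordIso unfolding regularCard_def by metis
    ultimately show "\<exists>v. v \<in> Field r \<and> ?K \<subseteq> underS r v"
      using not_cofinal_bounded[OF r(1)] by metis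
  qed (simp cong: image_cong_simp)
  then obtain f where f: "\<And>b. f b \<in> Field r" "\<And>b. f ` {a \<in> A. (a, b) \<in> R} \<subseteq> underS r (f b)"
    by metis
  show ?thesis by (rule that[of f]) (use f in blast)+
qed

context edge_blocks
begin

definition below :: "'k \<Rightarrow> 'a set" where
  "below j = (\<Union>i\<in>underS k j. B i)"

lemma large_edge_free:
  assumes chain: "\<nexists>x y. omega_one_chain adj x y"
  obtains H where "H \<subseteq> (\<Union>j\<in>Field k. B j)" "edge_free adj H" "{j \<in> Field k. |B j| \<le>o |H| } \<in> U"
proof (rule ccontr)
  assume "\<not> thesis"
  note no_large = that this
  \<comment> \<open>A full family without a rich vertex would already yield the required
    \<open>H\<close>.\<close>
  have rich: "\<exists>i x. i \<in> I \<and> x \<in> D i \<and> rich I D i x" if full: "full I D" for I D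
  proof (rule ccontr)
    assume "\<nexists>i x. i \<in> I \<and> x \<in> D i \<and> rich I D i x"
    then have no_rich: "\<not> rich I D i x" if "i \<in> I" "x \<in> D i" for i x using that by blast
    have "thesis" by (rule large_edge_free_if_no_rich[OF full no_rich no_large(1)])
    then show False using no_large(2) by contradiction
  qed
  \<comment> \<open>The earlier blocks have fewer than \<open>M j\<close> finite subsets, so ranks
    fit into \<open>M j\<close>, which is smaller than \<open>B j\<close>.\<close>
  have "\<exists>f. (\<forall>t. f t \<in> Field (M j)) \<and>
      (\<forall>u\<in>Fpow (below j). \<forall>t. (u, t) \<in> extends_below adj y \<longrightarrow> f u \<in> underS (M j) (f t))"
    if j: "j \<in> Field k" for j y
  proof -
    have "wf (extends_below adj y)" using chain by (intro wf_extends_below) blast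
    moreover have "|Fpow (below j)| <o M j"
      using M_regular[OF j] below_M[OF j] unfolding below_def by (intro Fpow_ordLess) auto
    ultimately obtain f where "\<And>t. f t \<in> Field (M j)"
      "\<And>u t. u \<in> Fpow (below j) \<Longrightarrow> (u, t) \<in> extends_below adj y \<Longrightarrow> f u \<in> underS (M j) (f t)"
      using rank_function M_regular[OF j] by metis
    then show ?thesis by blast
  qed
  then obtain rk where rk: "\<And>j y t. j \<in> Field k \<Longrightarrow> rk j y t \<in> Field (M j)"
    and rk_less: "\<And>j y u t. j \<in> Field k \<Longrightarrow> u \<in> Fpow (below j) \<Longrightarrow> (u, t) \<in> extends_below adj y
      \<Longrightarrow> rk j y u \<in> underS (M j) (rk j y t)"
    by metis
  have thin: "\<exists>D' \<rho>. full I D' \<and> (\<forall>j\<in>I. D' j \<subseteq> D j \<and> (\<forall>y\<in>D' j. rk j y s = \<rho> j))"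
    if full: "full I D" for I D s
  proof -
    have "\<exists>v. |{y \<in> D j. rk j y s = v}| =o |B j|" if "j \<in> I" for j
    proof -
      have j: "j \<in> Field k" and D: "|D j| =o |B j|"
        using full that subset_Field[of I] by (auto simp: full_def)
      have "(\<lambda>y. rk j y s) ` D j \<subseteq> Field (M j)" using rk[OF j] by blast
      then have "|(\<lambda>y. rk j y s) ` D j| <o |B j|"
        by (rule ordLess_subset[OF _ ordLess_Field[OF M_block[OF j]]])
      from regular_fibre[OF block_regular[OF j] block_Cinfinite[OF j] D this]
      show ?thesis by blast
    qed
    then obtain \<rho> where "\<And>j. j \<in> I \<Longrightarrow> |{y \<in> D j. rk j y s = \<rho> j}| =o |B j|" by metis
    then have "full I (\<lambda>j. {y \<in> D j. rk j y s = \<rho> j})"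
      using full by (auto simp: full_def)
    then show ?thesis by (intro exI[of _ "\<lambda>j. {y \<in> D j. rk j y s = \<rho> j}"] exI[of _ \<rho>]) auto
  qed
  \<comment> \<open>A state holds an index set, a full family, the finite chain \<open>s\<close>
    chosen so far and, per block, the common rank of \<open>s\<close>. All vertices still in the
    family are neighbours of every member of \<open>s\<close>.\<close>
  define inv where "inv = (\<lambda>(I, D, s, \<rho>). full I D \<and>
    (\<forall>j\<in>I. s \<in> Fpow (below j) \<and> (\<forall>y\<in>D j. rk j y s = \<rho> j \<and> (\<forall>z\<in>s. adj z y))))"
  define step where "step = (\<lambda>(I, D :: 'k \<Rightarrow> 'a set, s :: 'a set, \<rho>) (I', D' :: 'k \<Rightarrow> 'a set, s' :: 'a set, \<rho>').
    \<forall>j\<in>I'. j \<in> I \<and> \<rho>' j \<in> underS (M j) (\<rho> j))"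
  have "full (Field k) B" using Field_mem by (simp add: full_def card_of_refl)
  then obtain D0 \<rho>0 where 0: "full (Field k) D0" "\<And>j y. j \<in> Field k \<Longrightarrow> y \<in> D0 j \<Longrightarrow> rk j y {} = \<rho>0 j"
    using thin[of "Field k" B "{}"] by metis
  have start: "inv (Field k, D0, {}, \<rho>0)" using 0 by (auto simp: inv_def empty_in_Fpow)
  have next_state: "\<exists>st'. inv st' \<and> step st st'" if "inv st" for st
  proof -
    obtain I D s \<rho> where st: "st = (I, D, s, \<rho>)" by (metis prod_cases4)
    have full: "full I D" and s: "\<And>j. j \<in> I \<Longrightarrow> s \<in> Fpow (below j)"
      and \<rho>: "\<And>j y. j \<in> I \<Longrightarrow> y \<in> D j \<Longrightarrow> rk j y s = \<rho> j"
      and adj: "\<And>j y z. j \<in> I \<Longrightarrow> y \<in> D j \<Longrightarrow> z \<in> s \<Longrightarrow> adj z y"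
      using that by (auto simp: inv_def st)
    have I: "I \<subseteq> Field k" and DB: "\<And>j. j \<in> I \<Longrightarrow> D j \<subseteq> B j"
      using full subset_Field[of I] by (auto simp: full_def)
    obtain i x where i: "i \<in> I" "x \<in> D i" and "rich I D i x" using rich[OF full] by blast
    define J where "J = {j \<in> I. i \<in> underS k j \<and> |{y \<in> D j. adj x y}| =o |B j| }"
    \<comment> \<open>Richness of \<open>x\<close> is what makes its neighbours a full family again;
      thinning then fixes the rank of the longer chain.\<close>
    have "full J (\<lambda>j. {y \<in> D j. adj x y})"
      using \<open>rich I D i x\<close> DB by (auto simp: full_def rich_def J_def)
    from thin[OF this, of "insert x s"] obtain D' \<rho>' where full': "full J D'"
      and sub: "\<forall>j\<in>J. D' j \<subseteq> {y \<in> D j. adj x y} \<and> (\<forall>y\<in>D' j. rk j y (insert x s) = \<rho>' j)"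
      by (elim exE conjE)
    have D': "y \<in> D j" "adj x y" if "j \<in> J" "y \<in> D' j" for j y using sub that by blast+
    have \<rho>': "rk j y (insert x s) = \<rho>' j" if "j \<in> J" "y \<in> D' j" for j y using sub that by blast
    have J: "j \<in> I" "insert x s \<in> Fpow (below j)" if "j \<in> J" for j
    proof -
      show "j \<in> I" using that by (simp add: J_def)
      have "x \<in> below j" using that i DB[OF i(1)] by (auto simp: J_def below_def)
      then show "insert x s \<in> Fpow (below j)" using s[OF \<open>j \<in> I\<close>] by (auto simp: Fpow_def)
    qed
    have "inv (J, D', insert x s, \<rho>')"
      using full' \<rho>' J(2) D'(2) adj[OF J(1) D'(1)] by (auto simp: inv_def)
    moreover have "\<rho>' j \<in> underS (M j) (\<rho> j)" if j: "j \<in> J" for j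
    proof -
      have jk: "j \<in> Field k" using J(1)[OF j] I by blast
      have "|D' j| =o |B j|" using full' j by (simp add: full_def)
      \<comment> \<open>A single vertex \<open>y\<close> of \<open>D' j\<close> witnesses the drop:
        under its rank function \<open>s\<close> and \<open>insert x s\<close> take the constant
        values \<open>\<rho> j\<close> and \<open>\<rho>' j\<close>.\<close>
      then have "D' j \<noteq> {}"
        using block_Cinfinite[OF jk] card_of_ordIso_finite[of "D' j" "B j"]
        by (auto simp: cinfinite_def Field_card_of)
      then obtain y where y: "y \<in> D' j" by blast
      note xy = D'[OF j y]
      have "(insert x s, s) \<in> extends_below adj y"
        using xy adj[OF i] by (auto simp: extends_below_def)
      from rk_less[OF jk J(2)[OF j] this] show ?thesis
        using \<rho>'[OF j y] \<rho>[OF J(1)[OF j] xy(1)] by simp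
    qed
    ultimately show ?thesis using J(1) by (intro exI[of _ "(J, D', insert x s, \<rho>')"]) (auto simp: st step_def)
  qed
  obtain f where f: "inv (f n)" "step (f n) (f (Suc n))" for n
    using dependent_nat_choice[of "\<lambda>_. inv" "\<lambda>_. step"] start next_state by metis
  define I where "I n = fst (f n)" for n
  define \<rho> where "\<rho> n = snd (snd (snd (f n)))" for n
  have "I n \<in> U" for n using f(1)[of n] by (cases "f n") (simp add: I_def inv_def full_def)
  \<comment> \<open>Countable completeness keeps one block \<open>j\<close> alive at all stages, and
    there the ranks would descend forever in \<open>M j\<close>.\<close>
  then have "(\<Inter>n. I n) \<in> U" by (rule countable_INT_mem)
  then obtain j where j: "\<And>n. j \<in> I n" using empty_notin by (metis INT_E UNIV_I ex_in_conv)
  have "j \<in> Field k" using j[of 0] subset_Field[of "I 0"] \<open>\<And>n. I n \<in> U\<close> by blast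
  then have "wo_rel (M j)"
    using M_regular by (simp add: wo_rel_def card_order_on_well_order_on)
  then have "wf (M j - Id)" by (rule wo_rel.WF)
  moreover have "(\<rho> (Suc n) j, \<rho> n j) \<in> M j - Id" for n
    using f(2)[of n] j[of "Suc n"]
    by (cases "f n"; cases "f (Suc n)") (auto simp: I_def \<rho>_def step_def underS_def)
  ultimately show False
    unfolding wf_iff_no_infinite_down_chain by (elim notE) (intro exI[of _ "\<lambda>n. \<rho> n j"] allI)
qed

end

section \<open>Singular cardinals\<close>

text \<open>Carries the Galvin property from a given cardinal to the cardinality of a block.\<close>

lemma Gal_ordIso:
  assumes "Gal U m" "m =o m'" "Card_order m"
  shows "Gal U m'"
  unfolding Gal_def
proof (intro allI impI)
  fix C assume C: "\<forall>x\<in>Field m'. C x \<in> U"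
  have m': "|Field m'| =o m"
    by (rule ordIso_transitive[OF card_of_Field_ordIso[OF Card_order_ordIso2[OF assms(3,2)]]
          ordIso_symmetric[OF assms(2)]])
  obtain E where E: "E \<subseteq> Field m'" "|E| =o m" "(\<Inter>x\<in>E. C x) \<in> U"
    by (rule Gal_subset[OF assms(1,3) m', of C]) (use C in auto)
  have "|Field m'| =o |E|" by (rule ordIso_transitive[OF m' ordIso_symmetric[OF E(2)]])
  then obtain f where f: "bij_betw f (Field m') E" using card_of_ordIso by blast
  have "(\<Inter>i\<in>Field m'. C (f i)) = (\<Inter>x\<in>E. C x)" using f by (auto simp: bij_betw_def)
  then have "f ` Field m' \<subseteq> Field m' \<and> inj_on f (Field m') \<and> (\<Inter>i\<in>Field m'. C (f i)) \<in> U"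
    using f E by (simp add: bij_betw_def)
  then show "\<exists>f. f ` Field m' \<subseteq> Field m' \<and> inj_on f (Field m') \<and> (\<Inter>i\<in>Field m'. C (f i)) \<in> U"
    by (intro exI[of _ f])
qed

section \<open>Order types of subsets\<close>

text \<open>A cardinal is least among well-orders of its size, so \<open>H\<close> has type at least
  \<open>l\<close>. Were it larger, \<open>l\<close> would be isomorphic to an order on a subset of
  some \<open>underS l a\<close>, which is too small.\<close>

lemma Restr_ordIso_of_card:
  assumes l: "Card_order l" and H: "H \<subseteq> Field l" "|H| =o l"
  shows "Restr l H =o l"
proof -
  have wl: "Well_order l" using l by (simp add: card_order_on_well_order_on)
  have wH: "well_order_on H (Restr l H)" using wl H(1) by (rule well_order_on_Restr)
  have WH: "Well_order (Restr l H)" using wl by (rule Well_order_Restr)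
  have FH: "Field (Restr l H) = H" using wH by (metis well_order_on_Well_order)
  have "l \<le>o Restr l H"
    by (rule ordIso_ordLeq_trans[OF ordIso_symmetric[OF H(2)] card_of_least[OF wH]])
  moreover have "\<not> l <o Restr l H"
  proof
    assume "l <o Restr l H"
    then obtain a where a: "a \<in> H" and iso: "l =o Restr (Restr l H) (underS (Restr l H) a)"
      using ordLess_iff_ordIso_Restr[OF WH wl] FH by auto
    have "Field (Restr (Restr l H) (underS (Restr l H) a)) \<subseteq> underS l a"
      by (auto simp: Field_def underS_def)
    moreover have "|underS l a| <o l" using card_of_underS[OF l] a H(1) by blast
    ultimately have "|Field (Restr (Restr l H) (underS (Restr l H) a))| <o l"
      by (rule ordLess_subset)
    with card_of_cong[OF iso] have "|Field l| <o l" by (rule ordIso_ordLess_trans)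
    then show False using card_of_Field_ordIso[OF l] not_ordLess_ordIso by blast
  qed
  ultimately show ?thesis
    using ordLeq_iff_ordLess_or_ordIso ordIso_symmetric by blast
qed

text \<open>By trichotomy a strictly increasing map also reflects the order, so it is an isomorphism
  onto its image.\<close>

lemma Restr_image_ordIso:
  assumes r: "Well_order r" and l: "Well_order l" and f: "\<And>a. a \<in> Field r \<Longrightarrow> f a \<in> Field l"
    and less: "\<And>a b. a \<in> underS r b \<Longrightarrow> f a \<in> underS l (f b)"
  shows "Restr l (f ` Field r) =o r"
proof -
  have wo: "wo_rel r" "wo_rel l" using r l by (simp_all add: wo_rel_def)
  have W: "well_order_on (f ` Field r) (Restr l (f ` Field r))"
    using l f by (intro well_order_on_Restr) auto
  have trichotomy: "a = b \<or> a \<in> underS r b \<or> b \<in> underS r a" if "a \<in> Field r" "b \<in> Field r" for a b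
    using that wo_rel.TOTALS[OF wo(1)] by (auto simp: underS_def)
  have asym: "(v, u) \<notin> l" if "u \<in> underS l v" for u v
    using that antisymD[OF wo_rel.ANTISYM[OF wo(2)]] by (auto simp: underS_def)
  have refl: "(a, a) \<in> r" "(f a, f a) \<in> l" if "a \<in> Field r" for a
    using that f wo_rel.REFL[OF wo(1)] wo_rel.REFL[OF wo(2)] by (auto simp: refl_on_def)
  have "iso r (Restr l (f ` Field r)) f"
    unfolding iso_iff2
  proof (intro conjI ballI)
    have "inj_on f (Field r)"
    proof (rule inj_onI, rule ccontr)
      fix a b assume "a \<in> Field r" "b \<in> Field r" "f a = f b" "a \<noteq> b"
      then show False using trichotomy[of a b] less[of a b] less[of b a] by (auto simp: underS_def)
    qed
    then show "bij_betw f (Field r) (Field (Restr l (f ` Field r)))"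
      using well_order_on_Well_order[OF W] by (simp add: bij_betw_def)
  next
    fix a b assume ab: "a \<in> Field r" "b \<in> Field r"
    consider "a = b" | "a \<in> underS r b" | "b \<in> underS r a" using trichotomy[OF ab] by blast
    then show "((a, b) \<in> r) = ((f a, f b) \<in> Restr l (f ` Field r))"
    proof cases
      case 1
      then show ?thesis using refl ab by simp
    next
      case 2
      then show ?thesis using less[OF 2] ab by (simp add: underS_def)
    next
      case 3
      then have "(a, b) \<notin> r" using antisymD[OF wo_rel.ANTISYM[OF wo(1)], of a b] by (auto simp: underS_def)
      then show ?thesis using asym[OF less[OF 3]] by simp
    qed
  qed
  then have "r =o Restr l (f ` Field r)"
    using r well_order_on_Well_order[OF W] unfolding ordIso_def by blast
  then show ?thesis by (rule ordIso_symmetric)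
qed

lemma omega_plus_one_of_chain:
  fixes x :: "nat \<Rightarrow> 'a"
  assumes l: "Well_order l"
    and x: "\<And>n. x n \<in> underS l y" "\<And>m n. m < n \<Longrightarrow> x m \<in> underS l (x n)"
  shows "has_order_type l (insert y (range x)) omega_plus_one"
proof -
  define f where "f e = (case e of enat n \<Rightarrow> x n | \<infinity> \<Rightarrow> y)" for e
  have fld: "f e \<in> Field l" for e
  proof (cases e)
    case (enat n)
    then show ?thesis using x(1)[of n] by (auto simp: f_def underS_def Field_def)
  next
    case infinity
    then show ?thesis using x(1)[of 0] by (auto simp: f_def underS_def Field_def)
  qed
  have less: "f a \<in> underS l (f b)" if "a \<in> underS omega_plus_one b" for a b
  proof -
    have "a < b" using that by (auto simp: underS_def omega_plus_one_def)
    then show ?thesis using x by (cases a; cases b) (auto simp: f_def)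
  qed
  have range: "f ` Field omega_plus_one = insert y (range x)"
    unfolding Field_omega_plus_one
  proof (intro equalityI image_subsetI)
    show "f e \<in> insert y (range x)" for e by (cases e) (simp_all add: f_def)
    have "f (enat n) = x n" "f \<infinity> = y" for n by (simp_all add: f_def)
    then show "insert y (range x) \<subseteq> range f" by (metis image_subsetI insert_subset rangeI)
  qed
  have "Restr l (f ` Field omega_plus_one) =o omega_plus_one"
    by (rule Restr_image_ordIso[where f = f, OF Well_order_omega_plus_one l fld less])
  moreover have "f ` Field omega_plus_one \<subseteq> Field l" using fld by blast
  ultimately show ?thesis unfolding has_order_type_def range by (rule conjI[rotated])
qed

section \<open>Initial segments and cardinals below a singular cardinal\<close>

lemma Well_order_underS_subset:
  assumes "Well_order l" "a \<in> underS l b"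
  shows "insert a (underS l a) \<subseteq> underS l b"
proof -
  have wo: "wo_rel l" using assms(1) by (simp add: wo_rel_def)
  have "c \<in> underS l b" if c: "c \<in> underS l a" for c
  proof -
    have "(c, b) \<in> l"
      using c assms(2) transD[OF wo_rel.TRANS[OF wo], of c a b] by (simp add: underS_def)
    moreover have "c \<noteq> b"
      using c assms(2) antisymD[OF wo_rel.ANTISYM[OF wo], of a b] by (auto simp: underS_def)
    ultimately show ?thesis by (simp add: underS_def)
  qed
  with assms(2) show ?thesis by blast
qed

lemma Field_Restr_underS:
  assumes "Well_order l" "a \<in> Field l"
  shows "Field (Restr l (underS l a)) = underS l a"
  using assms by (intro Field_Restr_ofilter wo_rel.underS_ofilter) (simp_all add: wo_rel_def)

text \<open>\<open>m\<close> is isomorphic to a proper initial segment of \<open>l\<close>; that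
  segment is then a cardinal order, so its own proper segments are smaller.\<close>

lemma cardinal_below_as_underS:
  assumes l: "Well_order l" and m: "Card_order m" "m <o l"
  obtains a where "a \<in> Field l" "|underS l a| =o m" "\<And>v. v \<in> underS l a \<Longrightarrow> |underS l v| <o m"
proof -
  have wm: "Well_order m" using m(1) by (simp add: card_order_on_well_order_on)
  obtain a where a: "a \<in> Field l" and iso: "m =o Restr l (underS l a)"
    using ordLess_iff_ordIso_Restr[OF l wm] m(2) by blast
  let ?s = "Restr l (underS l a)"
  have s: "Card_order ?s" by (rule Card_order_ordIso2[OF m(1) iso])
  have Fs: "Field ?s = underS l a" by (rule Field_Restr_underS[OF l a])
  show ?thesis
  proof
    show "a \<in> Field l" by (rule a)
    show "|underS l a| =o m"
      using card_of_Field_ordIso[OF s] unfolding Fs by (rule ordIso_transitive[OF _ ordIso_symmetric[OF iso]])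
  next
    fix v assume v: "v \<in> underS l a"
    have "underS l v \<subseteq> underS ?s v"
      using Well_order_underS_subset[OF l v] v by (auto simp: underS_def)
    moreover have "|underS ?s v| <o ?s" using v Fs by (intro card_of_underS[OF s]) simp
    ultimately have "|underS l v| <o ?s" by (rule ordLess_subset)
    then show "|underS l v| <o m" by (rule ordLess_ordIso_trans[OF _ ordIso_symmetric[OF iso]])
  qed
qed

text \<open>The successor is at most \<open>l\<close>, and equality would make \<open>l\<close>
  regular, as infinite successors are. A finite \<open>r\<close> has a finite successor.\<close>

lemma singular_limit:
  assumes "singular_card l" "Card_order r" "r <o l"
  shows "cardSuc r <o l"
proof -
  have l: "Cinfinite l" "\<not> regularCard l" using assms(1) by (simp_all add: singular_card_def)
  show ?thesis
  proof (cases "finite (Field r)")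
    case True
    then have "Cfinite (cardSuc r)"
      using assms(2) by (simp add: cfinite_def cardSuc_finite cardSuc_Card_order)
    then show ?thesis using Cfinite_ordLess_Cinfinite l(1) by blast
  next
    case False
    have "\<not> cardSuc r =o l"
    proof
      assume iso: "cardSuc r =o l"
      have "Cinfinite (cardSuc r)"
        using False assms(2) by (simp add: cinfinite_def cardSuc_finite cardSuc_Card_order)
      from regularCard_ordIso[OF iso this infinite_cardSuc_regularCard[OF False assms(2)]]
      show False using l(2) by contradiction
    qed
    moreover have "cardSuc r \<le>o l" using cardSuc_least assms l(1) by blast
    ultimately show ?thesis using ordLeq_iff_ordLess_or_ordIso by blast
  qed
qed

text \<open>The hypothesis gives only a weak lower bound on \<open>m\<close>; starting from the
  successor of \<open>|underS l b|\<close> makes it strict.\<close>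

lemma singular_Galvin_step:
  fixes l :: "'a rel"
  assumes l: "singular_card l"
    and Gal: "\<forall>n :: 'a rel. Card_order n \<and> n <o l \<longrightarrow>
      (\<exists>m :: 'a rel. n \<le>o m \<and> m <o l \<and> Cinfinite m \<and> regularCard m \<and> Gal U m)"
    and b: "b \<in> Field l"
  obtains m :: "'a rel" and a where "a \<in> Field l" "Cinfinite m" "regularCard m" "Gal U m" "|underS l b| <o m"
    "|underS l a| =o m" "\<And>v. v \<in> underS l a \<Longrightarrow> |underS l v| <o m"
proof -
  have Cl: "Card_order l" and Wl: "Well_order l"
    using l by (auto simp: singular_card_def card_order_on_well_order_on)
  let ?r = "|underS l b|"
  have "cardSuc ?r <o l"
    by (rule singular_limit[OF l card_of_Card_order card_of_underS[OF Cl b]])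
  then obtain c where c: "|underS l c| =o cardSuc ?r" "c \<in> Field l"
    using cardinal_below_as_underS[OF Wl cardSuc_Card_order[OF card_of_Card_order]] by metis
  have "|underS l c| <o l" by (rule card_of_underS[OF Cl c(2)])
  then obtain m :: "'a rel" where m: "|underS l c| \<le>o m" "m <o l" "Cinfinite m" "regularCard m" "Gal U m"
    using Gal card_of_Card_order by blast
  have "?r <o |underS l c|"
    by (rule ordLess_ordIso_trans[OF cardSuc_greater[OF card_of_Card_order] ordIso_symmetric[OF c(1)]])
  then have less: "?r <o m" by (rule ordLess_ordLeq_trans[OF _ m(1)])
  obtain a where a: "a \<in> Field l" "|underS l a| =o m" "\<And>v. v \<in> underS l a \<Longrightarrow> |underS l v| <o m"
    by (rule cardinal_below_as_underS[OF Wl _ m(2)]) (use m(3) in blast)+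
  show ?thesis by (rule that[OF a(1) m(3-5) less a(2,3)])
qed

section \<open>Cutting a singular cardinal into blocks\<close>

lemma singular_edge_free:
  fixes k :: "'k rel" and l :: "'a rel" and U :: "'k set set"
  assumes k: "normal_measure k U" and l: "singular_card l" and cf: "is_cofinality l k"
    and Gal: "\<forall>n :: 'a rel. Card_order n \<and> n <o l \<longrightarrow>
      (\<exists>m :: 'a rel. n \<le>o m \<and> m <o l \<and> Cinfinite m \<and> regularCard m \<and> Gal U m)"
    and adj: "\<And>x y. adj x y \<Longrightarrow> x \<in> underS l y"
    and chain: "\<nexists>x y. omega_one_chain adj x y"
  obtains H where "H \<subseteq> Field l" "edge_free adj H" "|H| =o l"
proof -
  interpret normal_ultrafilter k U by unfold_locales (rule k)
  let ?s = "underS l"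
  have Cl: "Cinfinite l" and Wl: "Well_order l"
    using l by (auto simp: singular_card_def card_order_on_well_order_on)
  have wol: "wo_rel l" using Wl by (simp add: wo_rel_def)
  have wok: "wo_rel k" using Card_order by (simp add: wo_rel_def card_order_on_well_order_on)
  have s_mono: "?s a \<subseteq> ?s b" if "a \<in> ?s b" for a b
    using Well_order_underS_subset[OF Wl that] by blast
  \<comment> \<open>\<open>b\<close> and \<open>a\<close> are the lower and upper ends of a future
    block: the segment below \<open>a\<close> has the regular Galvin size \<open>L\<close>, and
    \<open>M\<close> separates it from the segment below \<open>b\<close>.\<close>
  define good where "good b M L a \<longleftrightarrow> a \<in> Field l \<and> (Cinfinite M \<and> regularCard M) \<and> |?s b| <o M \<and> M <o L \<and>
      (Cinfinite L \<and> regularCard L \<and> Gal U L) \<and> |?s a| =o L \<and> (\<forall>v\<in>?s a. |?s v| <o L)"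
    for b a and M L :: "'a rel"
  have "\<exists>M L a. good b M L a"
    if b: "b \<in> Field l" for b
  proof -
    obtain M :: "'a rel" and c where M: "c \<in> Field l" "Cinfinite M" "regularCard M" "|?s b| <o M" "|?s c| =o M"
      by (rule singular_Galvin_step[OF l Gal b]) blast
    obtain L :: "'a rel" and a where L: "a \<in> Field l" "Cinfinite L" "regularCard L" "Gal U L" "|?s c| <o L"
      "|?s a| =o L" "\<And>v. v \<in> ?s a \<Longrightarrow> |?s v| <o L"
      by (rule singular_Galvin_step[OF l Gal M(1)]) blast
    have "M <o L" by (rule ordIso_ordLess_trans[OF ordIso_symmetric[OF M(5)] L(5)])
    with M L have "good b M L a" by (simp add: good_def)
    then show ?thesis by (intro exI)
  qed
  then obtain M L a where good: "\<And>b. b \<in> Field l \<Longrightarrow> good b (M b) (L b) (a b)" by metis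
  note good = good[unfolded good_def]
  have a: "\<And>b. b \<in> Field l \<Longrightarrow> a b \<in> Field l"
    and M: "\<And>b. b \<in> Field l \<Longrightarrow> Cinfinite (M b) \<and> regularCard (M b)"
    and sM: "\<And>b. b \<in> Field l \<Longrightarrow> |?s b| <o M b" and M_less: "\<And>b. b \<in> Field l \<Longrightarrow> M b <o L b"
    and L: "\<And>b. b \<in> Field l \<Longrightarrow> Cinfinite (L b) \<and> regularCard (L b) \<and> Gal U (L b)"
    and sa: "\<And>b. b \<in> Field l \<Longrightarrow> |?s (a b)| =o L b"
    and sv: "\<And>b v. b \<in> Field l \<Longrightarrow> v \<in> ?s (a b) \<Longrightarrow> |?s v| <o L b"
    using good by simp_all
  obtain A where A: "A \<subseteq> Field l" "cofinal A l" "|A| =o k"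
    using cf by (auto simp: is_cofinality_def)
  have "|Field k| =o |A|"
    by (rule ordIso_transitive[OF card_of_Field_ordIso[OF Card_order] ordIso_symmetric[OF A(3)]])
  then obtain g where g: "bij_betw g (Field k) A" using card_of_ordIso by blast
  \<comment> \<open>Recursion on \<open>k\<close>: fewer than \<open>k = cf(l)\<close> points are
    bounded, so \<open>\<beta> j\<close> can exceed all earlier upper ends and the
    \<open>j\<close>-th point of a cofinal set.\<close>
  have "\<exists>\<beta>. \<forall>j. j \<in> Field k \<longrightarrow> \<beta> j \<in> Field l \<and> insert (g j) ((\<lambda>i. a (\<beta> i)) ` underS k j) \<subseteq> ?s (\<beta> j)"
  proof (rule dependent_wf_choice[OF wo_rel.WF[OF wok], where P =
        "\<lambda>\<beta> j v. j \<in> Field k \<longrightarrow> v \<in> Field l \<and> insert (g j) ((\<lambda>i. a (\<beta> i)) ` underS k j) \<subseteq> ?s v"])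
    fix f h :: "'k \<Rightarrow> 'a" and j v
    assume "\<And>z. (z, j) \<in> k - Id \<Longrightarrow> f z = h z"
    then have "(\<lambda>i. a (f i)) ` underS k j = (\<lambda>i. a (h i)) ` underS k j"
      by (intro image_cong) (auto simp: underS_def)
    then show "(j \<in> Field k \<longrightarrow> v \<in> Field l \<and> insert (g j) ((\<lambda>i. a (f i)) ` underS k j) \<subseteq> ?s v) =
        (j \<in> Field k \<longrightarrow> v \<in> Field l \<and> insert (g j) ((\<lambda>i. a (h i)) ` underS k j) \<subseteq> ?s v)"
      by simp
  next
    fix j and \<beta> :: "'k \<Rightarrow> 'a"
    assume IH: "\<And>i. (i, j) \<in> k - Id \<Longrightarrow> i \<in> Field k \<longrightarrow> \<beta> i \<in> Field l \<and>
      insert (g i) ((\<lambda>i'. a (\<beta> i')) ` underS k i) \<subseteq> ?s (\<beta> i)"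
    show "\<exists>v. j \<in> Field k \<longrightarrow> v \<in> Field l \<and> insert (g j) ((\<lambda>i. a (\<beta> i)) ` underS k j) \<subseteq> ?s v"
    proof (cases "j \<in> Field k")
      case True
      let ?K = "{g j} \<union> (\<lambda>i. a (\<beta> i)) ` underS k j"
      have "\<beta> i \<in> Field l" if "i \<in> underS k j" for i
        using IH[of i] that by (auto simp: underS_def Field_def)
      then have K: "?K \<subseteq> Field l" using g A(1) True a by (auto simp: bij_betw_def)
      have "|?K| <o k"
      proof (rule card_of_Un_ordLess_infinite_Field)
        show "|{g j}| <o k" using Cinfinite by (intro finite_ordLess_Cinfinite) simp_all
        show "|(\<lambda>i. a (\<beta> i)) ` underS k j| <o k"
          by (rule ordLeq_ordLess_trans[OF card_of_image card_of_underS[OF Card_order True]])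
      qed (use Cinfinite in \<open>simp_all add: cinfinite_def\<close>)
      then have "\<not> cofinal ?K l"
        using cf K not_ordLess_ordLeq unfolding is_cofinality_def by metis
      then obtain v where "v \<in> Field l" "?K \<subseteq> ?s v" by (rule not_cofinal_bounded[OF Cl K])
      then show ?thesis by auto
    qed simp
  qed
  then obtain \<beta> where bound: "\<And>j. j \<in> Field k \<Longrightarrow> \<beta> j \<in> Field l"
      "\<And>j. j \<in> Field k \<Longrightarrow> insert (g j) ((\<lambda>i. a (\<beta> i)) ` underS k j) \<subseteq> ?s (\<beta> j)"
    by metis
  note \<beta> = bound(1)
  have g\<beta>: "g j \<in> ?s (\<beta> j)" if "j \<in> Field k" for j using bound(2)[OF that] by simp
  have a\<beta>: "a (\<beta> i) \<in> ?s (\<beta> j)" if "j \<in> Field k" "i \<in> underS k j" for i j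
    using bound(2)[OF that(1)] that(2) by (auto simp: image_subset_iff)
  have sub: "(\<Union>i\<in>underS k j. ?s (a (\<beta> i))) \<subseteq> ?s (\<beta> j)" if "j \<in> Field k" for j
    by (rule UN_least) (rule s_mono[OF a\<beta>[OF that]])
  have "\<exists>B. B \<subseteq> ?s (a (\<beta> j)) - (\<Union>i\<in>underS k j. ?s (a (\<beta> i))) \<and> |B| =o L (\<beta> j) \<and> edge_free adj B"
    if j: "j \<in> Field k" for j
  proof -
    let ?S = "?s (a (\<beta> j)) - (\<Union>i\<in>underS k j. ?s (a (\<beta> i)))"
    note b = \<beta>[OF j]
    have "natLeq \<le>o M (\<beta> j)" using M[OF b] by (intro natLeq_ordLeq_cinfinite) simp
    \<comment> \<open>Lying strictly above an infinite cardinal, \<open>L (\<beta> j)\<close> is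
      uncountable, as the regular case demands.\<close>
    then have unc: "natLeq <o L (\<beta> j)" by (rule ordLeq_ordLess_trans[OF _ M_less[OF b]])
    have "|\<Union>i\<in>underS k j. ?s (a (\<beta> i))| <o L (\<beta> j)"
      by (rule ordLess_subset[OF sub[OF j] ordLess_transitive[OF sM[OF b] M_less[OF b]]])
    then have S: "|?S| =o L (\<beta> j)" using L[OF b] by (intro Diff_ordIso sa[OF b]) simp_all
    show ?thesis
    proof (rule regular_edge_free[OF Wl _ _ chain _ _ unc S])
      show "?S \<subseteq> Field l" by (auto simp: underS_def Field_def)
      show "(x, y) \<in> l \<and> x \<noteq> y" if "adj x y" for x y using adj[OF that] by (simp add: underS_def)
      show "|?S \<inter> ?s v| <o L (\<beta> j)" if "v \<in> ?S" for v
        using that by (intro ordLess_subset[OF _ sv[OF b]]) auto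
    qed (use L[OF b] in blast)+
  qed
  then obtain B where B: "\<And>j. j \<in> Field k \<Longrightarrow> B j \<subseteq> ?s (a (\<beta> j)) - (\<Union>i\<in>underS k j. ?s (a (\<beta> i)))"
    and cardB: "\<And>j. j \<in> Field k \<Longrightarrow> |B j| =o L (\<beta> j)" and freeB: "\<And>j. j \<in> Field k \<Longrightarrow> edge_free adj (B j)"
    by metis
  have LB: "L (\<beta> j) =o |B j|" if "j \<in> Field k" for j by (rule ordIso_symmetric[OF cardB[OF that]])
  have kF: "i \<in> Field k" if "i \<in> underS k j" for i j using that by (auto simp: underS_def Field_def)
  interpret edge_blocks k U B "\<lambda>j. M (\<beta> j)" adj
  proof unfold_locales
    fix j assume j: "j \<in> Field k"
    note b = \<beta>[OF j]
    show "edge_free adj (B j)" by (rule freeB[OF j])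
    show "regularCard |B j|" using regularCard_ordIso[OF LB[OF j]] L[OF b] by blast
    show "Cinfinite (M (\<beta> j)) \<and> regularCard (M (\<beta> j))" by (rule M[OF b])
    have "(\<Union>i\<in>underS k j. B i) \<subseteq> (\<Union>i\<in>underS k j. ?s (a (\<beta> i)))"
      by (rule UN_mono) (use B kF in auto)
    then have "(\<Union>i\<in>underS k j. B i) \<subseteq> ?s (\<beta> j)" using sub[OF j] by (rule order_trans)
    then show "|\<Union>i\<in>underS k j. B i| <o M (\<beta> j)" by (rule ordLess_subset[OF _ sM[OF b]])
    show "M (\<beta> j) <o |B j|" by (rule ordLess_ordIso_trans[OF M_less[OF b] LB[OF j]])
    show "Gal U |B j|" using Gal_ordIso[OF _ LB[OF j]] L[OF b] by blast
  next
    fix i j x y assume ij: "j \<in> Field k" "i \<in> underS k j" and xy: "x \<in> B i" "y \<in> B j"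
    have "x \<in> ?s (a (\<beta> i))" using B[OF kF[OF ij(2)]] xy(1) by blast
    moreover have "y \<notin> ?s (a (\<beta> i))" using B[OF ij(1)] xy(2) ij(2) by blast
    ultimately have "y \<notin> ?s x" using s_mono by blast
    then show "\<not> adj y x" using adj by blast
  qed
  obtain H where H: "H \<subseteq> (\<Union>j\<in>Field k. B j)" "edge_free adj H" "{j \<in> Field k. |B j| \<le>o |H| } \<in> U"
    by (rule large_edge_free[OF chain])
  have HF: "H \<subseteq> Field l"
  proof
    fix x assume "x \<in> H"
    then obtain j where "j \<in> Field k" "x \<in> B j" using H(1) by blast
    then have "x \<in> ?s (a (\<beta> j))" using B by blast
    then show "x \<in> Field l" by (auto simp: underS_def Field_def)
  qed
  \<comment> \<open>If \<open>H\<close> were small, some \<open>b\<close> would have a segment of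
    size \<open>|H|\<close>. For a late \<open>j\<close> this segment lies below
    \<open>\<beta> j\<close>, hence is smaller than \<open>B j\<close>, although
    \<open>|B j| \<le>o |H|\<close>.\<close>
  have "\<not> |H| <o l"
  proof
    assume small: "|H| <o l"
    obtain b where b: "b \<in> Field l" "|?s b| =o |H|"
      using cardinal_below_as_underS[OF Wl card_of_Card_order small] by metis
    obtain i where i: "i \<in> Field k" "b \<in> ?s (g i)"
      using A(2) b(1) g unfolding cofinal_def bij_betw_def underS_def by blast
    have "?s b \<subseteq> ?s (\<beta> i)" using s_mono[OF i(2)] s_mono[OF g\<beta>[OF i(1)]] by (rule order_trans)
    obtain j where j: "j \<in> Field k" "|B j| \<le>o |H|" "i \<in> underS k j"
      using Int_empty[OF H(3) tail_mem[OF i(1)]] by blast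
    have "?s (\<beta> i) \<subseteq> ?s (\<beta> j)"
    proof -
      \<comment> \<open>By size, \<open>a (\<beta> i)\<close> must exceed \<open>\<beta> i\<close>,
        and \<open>\<beta> j\<close> exceeds \<open>a (\<beta> i)\<close>.\<close>
      have "\<not> ?s (a (\<beta> i)) \<subseteq> ?s (\<beta> i)"
      proof
        assume "?s (a (\<beta> i)) \<subseteq> ?s (\<beta> i)"
        then have "|?s (a (\<beta> i))| <o L (\<beta> i)"
          using \<beta>[OF i(1)] by (intro ordLess_subset[OF _ ordLess_transitive[OF sM M_less]])
        then show False using sa[OF \<beta>[OF i(1)]] not_ordLess_ordIso by blast
      qed
      then have "\<beta> i \<in> ?s (a (\<beta> i))"
        using wo_rel.TOTALS[OF wol] \<beta>[OF i(1)] a[OF \<beta>[OF i(1)]] s_mono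
        by (metis order_refl underS_I)
      then show ?thesis using s_mono a\<beta>[OF j(1,3)] by blast
    qed
    with \<open>?s b \<subseteq> ?s (\<beta> i)\<close> have "?s b \<subseteq> ?s (\<beta> j)" by (rule order_trans)
    then have "|?s b| <o L (\<beta> j)"
      by (rule ordLess_subset[OF _ ordLess_transitive[OF sM[OF \<beta>[OF j(1)]] M_less[OF \<beta>[OF j(1)]]]])
    then have "|?s b| <o |B j|" by (rule ordLess_ordIso_trans[OF _ LB[OF j(1)]])
    then have "|?s b| <o |H|" by (rule ordLess_ordLeq_trans[OF _ j(2)])
    then show False using b(2) not_ordLess_ordIso by blast
  qed
  then have "|H| =o l"
    using ordIso_of_subset[OF HF card_of_Field_ordIso] Cl by blast
  then show ?thesis by (rule that[OF HF H(2)])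
qed

theorem corollary3p5:
  fixes k :: "'k rel" and l :: "'a rel" and U :: "'k set set"
  assumes "normal_measure k U"
    and "singular_card l"
    and "is_cofinality l k"
    and "\<forall>n :: 'a rel. Card_order n \<and> n <o l \<longrightarrow>
           (\<exists>m :: 'a rel. n \<le>o m \<and> m <o l \<and> Cinfinite m \<and> regularCard m \<and> Gal U m)"
  shows "arrow2 l l omega_plus_one"
  unfolding arrow2_def
proof (intro ballI)
  fix c assume c: "c \<in> [Field l]\<^bsup>2\<^esup> \<rightarrow> {..<2::nat}"
  have Cl: "Card_order l" and Wl: "Well_order l"
    using assms(2) by (auto simp: singular_card_def card_order_on_well_order_on)
  define adj where "adj x y \<longleftrightarrow> x \<in> underS l y \<and> c {x, y} = 1" for x y
  show "(\<exists>A. has_order_type l A l \<and> (\<forall>e \<in> [A]\<^bsup>2\<^esup>. c e = 0)) \<or>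
        (\<exists>B. has_order_type l B omega_plus_one \<and> (\<forall>e \<in> [B]\<^bsup>2\<^esup>. c e = 1))"
  proof (cases "\<exists>x y. omega_one_chain adj x y")
    case True
    then obtain x y where "omega_one_chain adj x y" by blast
    then have y: "\<And>n. adj (x n) y" and x: "\<And>m n. m < n \<Longrightarrow> adj (x m) (x n)"
      by (auto simp: omega_one_chain_def)
    have "has_order_type l (insert y (range x)) omega_plus_one"
      by (rule omega_plus_one_of_chain[OF Wl]) (use x y in \<open>auto simp: adj_def\<close>)
    moreover have "c e = 1" if e_in: "e \<in> [insert y (range x)]\<^bsup>2\<^esup>" for e
    proof -
      obtain u v where e: "e = {u, v}" "u \<in> insert y (range x)" "v \<in> insert y (range x)" "u \<noteq> v"
        using e_in by (elim nsets2_E)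
      \<comment> \<open>The colour is that of an unordered pair, so either order of the indices
        serves.\<close>
      have xx: "c {x m, x n} = 1" if "x m \<noteq> x n" for m n
      proof -
        have "m < n \<or> n < m" using that by (metis linorder_neqE_nat)
        then show ?thesis using x[of m n] x[of n m] by (auto simp: adj_def insert_commute)
      qed
      have xy: "c {x n, y} = 1" "c {y, x n} = 1" for n
        using y[of n] by (auto simp: adj_def insert_commute)
      show ?thesis using e(2-4) xx xy by (auto simp: e(1))
    qed
    ultimately show ?thesis by blast
  next
    case False
    obtain H where H: "H \<subseteq> Field l" "edge_free adj H" "|H| =o l"
      by (rule singular_edge_free[OF assms _ False]) (auto simp: adj_def)
    have "has_order_type l H l"
      unfolding has_order_type_def using Restr_ordIso_of_card[OF Cl H(1,3)] H(1) by blast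
    moreover have "c e = 0" if e: "e \<in> [H]\<^bsup>2\<^esup>" for e
    proof -
      obtain u v where uv: "e = {u, v}" "u \<in> H" "v \<in> H" "u \<noteq> v" using e by (elim nsets2_E)
      have "wo_rel l" using Wl by (simp add: wo_rel_def)
      then have "u \<in> underS l v \<or> v \<in> underS l u"
        using uv H(1) wo_rel.TOTALS[of l] by (metis subsetD underS_I)
      then have "c e \<noteq> 1"
        using H(2) uv by (auto simp: edge_free_def adj_def insert_commute)
      moreover have "c e \<in> {..<2}" using c uv H(1) by (intro Pi_mem[OF c]) auto
      ultimately show ?thesis by auto
    qed
    ultimately show ?thesis by blast
  qed
qed

end
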